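(* Let $a,b$ be positive integers and let $\mathrm{Im}\,\tau>0$. Then, as meromorphic functions of $z$, \[ \Gamma(z,a\tau,b\tau)=\prod_{r=0}^{b-1}\prod_{s=0}^{a-1}\Gamma(z+(ar+bs)\tau,ab\tau,ab\tau). \]
   Context: For $\mathrm{Im}\,\tau,\mathrm{Im}\,\sigma>0$ the elliptic gamma function is \[ \Gamma(z,\tau,\sigma)=\prod_{j,k=0}^\infty\frac{1-e^{2\pi i((j+1)\tau+(k+1)\sigma-z)}}{1-e^{2\pi i(j\tau+k\sigma+z)}}. \] *)

theory Defs
  imports "HOL-Complex_Analysis.Complex_Analysis"
begin

text \<open>
  The double product is the limit of the finite partial products along the net of all
  finite sets of index pairs (the multiplicative analogue of \<^const>\<open>infsum\<close>), so no
  order of multiplication is singled out. It is meant for \<open>Im \<tau> > 0\<close> and \<open>Im \<sigma> > 0\<close>.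
  As \<open>x / 0 = 0\<close>, the value is \<open>0\<close> where a denominator vanishes, which happens
  exactly at the poles in \<open>z\<close>.
\<close>

definition elliptic_gamma :: "complex \<Rightarrow> complex \<Rightarrow> complex \<Rightarrow> complex" where
  "elliptic_gamma z \<tau> \<sigma> =
     Lim (finite_subsets_at_top (UNIV :: (nat \<times> nat) set))
       (\<lambda>F. \<Prod>(j, k)\<in>F.
          (1 - exp (2 * of_real pi * \<i> * (of_nat (j + 1) * \<tau> + of_nat (k + 1) * \<sigma> - z))) /
          (1 - exp (2 * of_real pi * \<i> * (of_nat j * \<tau> + of_nat k * \<sigma> + z))))"

text \<open>
  Equality of meromorphic functions on the plane: both are meromorphic, and they have the
  same value at every point that is a pole of neither; the value stored at a pole is ignored.
\<close>

definition eq_meromorphic :: "(complex \<Rightarrow> complex) \<Rightarrow> (complex \<Rightarrow> complex) \<Rightarrow> bool" where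
  "eq_meromorphic f g \<longleftrightarrow>
     f meromorphic_on UNIV \<and> g meromorphic_on UNIV \<and>
     (\<forall>z. \<not> is_pole f z \<and> \<not> is_pole g z \<longrightarrow> f z = g z)"

end

theory Submission
  imports Defs
begin

text \<open>
  Write \<open>E(z, \<tau>, \<sigma>) = \<Prod>\<^sub>j\<^sub>,\<^sub>k (1 - e(j\<tau> + k\<sigma> + z))\<close> with \<open>e(x) = exp(2\<pi>ix)\<close>, the product over all pairs
  of natural numbers. For \<open>Im \<tau>, Im \<sigma> > 0\<close> it converges absolutely and locally uniformly in \<open>z\<close>, hence is entire in \<open>z\<close>,
  and it vanishes exactly where one of its factors does. Consequently
  \<open>\<Gamma>(z, \<tau>, \<sigma>) = E(\<tau> + \<sigma> - z, \<tau>, \<sigma>) / E(z, \<tau>, \<sigma>)\<close>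
  holds at \<^emph>\<open>every\<close> \<open>z\<close>, both sides being \<open>0\<close> at the zeros of the denominator
  (\<open>elliptic_gamma_eq_double_qprod_quotient\<close>); in particular \<open>\<Gamma>\<close> is meromorphic.

  Division with remainder, \<open>j = m j' + r\<close> and \<open>k = n k' + s\<close>, splits \<open>E(z, \<tau>, \<sigma>)\<close> into the \<open>m n\<close> factors
  \<open>E(z + r\<tau> + s\<sigma>, m\<tau>, n\<sigma>)\<close> (\<open>double_qprod_multiplication\<close>). Take \<open>m = b\<close> and \<open>n = a\<close> with the periods
  \<open>a\<tau>\<close> and \<open>b\<tau>\<close>, so that all the factors get both periods equal to \<open>ab\<tau>\<close>. The denominators then match
  directly, and the numerators match after replacing \<open>(r, s)\<close> by \<open>(b-1-r, a-1-s)\<close>. The two sides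
  therefore agree at every point, poles included.
\<close>

section \<open>Unordered infinite products\<close>

lemma norm_prod_minus_1_le_exp_sum:
  fixes f :: "'a \<Rightarrow> 'b :: {real_normed_field}"
  assumes "finite F"
  shows "norm ((\<Prod>x\<in>F. 1 + f x) - 1) \<le> exp (\<Sum>x\<in>F. norm (f x)) - 1"
  using assms
proof (induction F)
  case (insert x F)
  let ?P = "\<Prod>x\<in>F. 1 + f x" and ?S = "\<Sum>x\<in>F. norm (f x)"
  have "(\<Prod>x\<in>insert x F. 1 + f x) - 1 = (1 + f x) * (?P - 1) + f x"
    using insert by (simp add: algebra_simps)
  also have "norm \<dots> \<le> norm (1 + f x) * norm (?P - 1) + norm (f x)"
    by (metis norm_mult norm_triangle_ineq)
  also have "\<dots> \<le> (1 + norm (f x)) * (exp ?S - 1) + norm (f x)"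
    using insert norm_triangle_ineq[of 1 "f x"] by (intro add_mono mult_mono) auto
  also have "\<dots> = (1 + norm (f x)) * exp ?S - 1"
    by (simp add: algebra_simps)
  also have "\<dots> \<le> exp (norm (f x)) * exp ?S - 1"
    by (intro diff_right_mono mult_right_mono exp_ge_add_one_self) auto
  finally show ?case
    using insert by (simp add: exp_add)
qed auto

lemma summable_on_tail_less:
  fixes M :: "'a \<Rightarrow> real"
  assumes M: "M summable_on A" and nonneg: "\<And>x. x \<in> A \<Longrightarrow> 0 \<le> M x" and "0 < e"
  obtains F0 where "finite F0" "F0 \<subseteq> A"
    "\<And>G. finite G \<Longrightarrow> G \<subseteq> A - F0 \<Longrightarrow> sum M G < e"
proof -
  have "(sum M \<longlongrightarrow> infsum M A) (finite_subsets_at_top A)"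
    using has_sum_infsum[OF M] by (simp add: has_sum_def)
  then have "\<forall>\<^sub>F F in finite_subsets_at_top A. dist (sum M F) (infsum M A) < e"
    using \<open>0 < e\<close> by (rule tendstoD)
  then obtain F0 where F0: "finite F0" "F0 \<subseteq> A" "dist (sum M F0) (infsum M A) < e"
    unfolding eventually_finite_subsets_at_top by blast
  have "sum M G < e" if G: "finite G" "G \<subseteq> A - F0" for G
  proof -
    have "sum M F0 + sum M G = sum M (F0 \<union> G)"
      using F0 G by (intro sum.union_disjoint[symmetric]) auto
    also have "\<dots> \<le> infsum M A"
      using F0 G nonneg by (intro finite_sum_le_infsum M) auto
    finally show ?thesis using F0(3) by (auto simp: dist_real_def)
  qed
  with F0 that show ?thesis by blast
qed

lemma prod_tail_near_1:
  fixes f :: "'a \<Rightarrow> 'b \<Rightarrow> complex"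
  assumes M: "M summable_on A" and f: "\<And>x z. x \<in> A \<Longrightarrow> z \<in> K \<Longrightarrow> norm (f x z) \<le> M x"
    and nonneg: "\<And>x. x \<in> A \<Longrightarrow> 0 \<le> M x" and "0 < e"
  obtains F0 where "finite F0" "F0 \<subseteq> A"
    "\<And>G z. finite G \<Longrightarrow> G \<subseteq> A - F0 \<Longrightarrow> z \<in> K \<Longrightarrow> norm ((\<Prod>x\<in>G. 1 + f x z) - 1) < e"
proof -
  have "0 < ln (1 + e)" using \<open>0 < e\<close> by simp
  from summable_on_tail_less[OF M nonneg this] obtain F0 where F0: "finite F0" "F0 \<subseteq> A"
    and tail: "\<And>G. finite G \<Longrightarrow> G \<subseteq> A - F0 \<Longrightarrow> sum M G < ln (1 + e)" by blast
  have "norm ((\<Prod>x\<in>G. 1 + f x z) - 1) < e" if G: "finite G" "G \<subseteq> A - F0" "z \<in> K" for G z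
  proof -
    have "(\<Sum>x\<in>G. norm (f x z)) \<le> sum M G"
      using G f by (intro sum_mono) auto
    also have "\<dots> < ln (1 + e)" by (rule tail) fact+
    finally have "exp (\<Sum>x\<in>G. norm (f x z)) < 1 + e"
      using \<open>0 < e\<close> by (metis add_pos_pos exp_less_cancel_iff exp_ln zero_less_one)
    with norm_prod_minus_1_le_exp_sum[OF G(1), of "\<lambda>x. f x z"] show ?thesis by linarith
  qed
  with F0 that show ?thesis by blast
qed

text \<open>
  The multiplicative counterpart of the Weierstrass M-test, for products along the net of finite
  subsets.
\<close>

lemma Weierstrass_m_test_unordered_prod:
  fixes f :: "'a \<Rightarrow> 'b \<Rightarrow> complex"
  assumes M: "M summable_on A" and f: "\<And>x z. x \<in> A \<Longrightarrow> z \<in> K \<Longrightarrow> norm (f x z) \<le> M x"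
    and nonneg: "\<And>x. x \<in> A \<Longrightarrow> 0 \<le> M x"
  shows "uniform_limit K (\<lambda>F z. \<Prod>x\<in>F. 1 + f x z)
    (\<lambda>z. Lim (finite_subsets_at_top A) (\<lambda>F. \<Prod>x\<in>F. 1 + f x z)) (finite_subsets_at_top A)"
proof -
  define P where "P = (\<lambda>F z. \<Prod>x\<in>F. 1 + f x z)"
  define C where "C = exp (infsum M A)"
  have "C > 0" by (simp add: C_def)
  have bound: "norm (P F z) \<le> C" if "finite F" "F \<subseteq> A" "z \<in> K" for F z
  proof -
    have "norm (P F z) \<le> norm (P F z - 1) + 1"
      using norm_triangle_sub[of "P F z" 1] by simp
    also have "\<dots> \<le> exp (\<Sum>x\<in>F. norm (f x z))"
      using norm_prod_minus_1_le_exp_sum[OF that(1), of "\<lambda>x. f x z"] by (simp add: P_def)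
    also have "(\<Sum>x\<in>F. norm (f x z)) \<le> sum M F"
      using that f by (intro sum_mono) auto
    also have "sum M F \<le> infsum M A"
      using that nonneg by (intro finite_sum_le_infsum M) auto
    finally show ?thesis by (simp add: C_def)
  qed
  \<comment> \<open>The partial products are uniformly Cauchy: they are bounded by \<open>C\<close>, and enlarging \<open>F0\<close> multiplies
    by a factor close to \<open>1\<close>.\<close>
  have near: "\<exists>F0. finite F0 \<and> F0 \<subseteq> A \<and>
      (\<forall>F z. finite F \<and> F0 \<subseteq> F \<and> F \<subseteq> A \<and> z \<in> K \<longrightarrow> dist (P F z) (P F0 z) < e)"
    if "0 < e" for e
  proof -
    have "0 < e / C" using \<open>0 < C\<close> \<open>0 < e\<close> by simp
    from prod_tail_near_1[where K = K and f = f, OF M f nonneg this] obtain F0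
      where F0: "finite F0" "F0 \<subseteq> A"
      and tail: "\<And>G z. finite G \<Longrightarrow> G \<subseteq> A - F0 \<Longrightarrow> z \<in> K \<Longrightarrow> norm (P G z - 1) < e / C"
      unfolding P_def by blast
    have "dist (P F z) (P F0 z) < e" if F: "finite F" "F0 \<subseteq> F" "F \<subseteq> A" "z \<in> K" for F z
    proof -
      have "P F z = P F0 z * P (F - F0) z"
        unfolding P_def using F by (metis mult.commute prod.subset_diff)
      then have "dist (P F z) (P F0 z) = norm (P F0 z * (P (F - F0) z - 1))"
        by (simp add: dist_norm algebra_simps)
      also have "\<dots> \<le> C * norm (P (F - F0) z - 1)"
        unfolding norm_mult using bound F F0 by (intro mult_right_mono) auto
      also have "\<dots> < C * (e / C)"
        using F \<open>0 < C\<close> by (intro mult_strict_left_mono tail) auto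
      finally show ?thesis using \<open>0 < C\<close> by simp
    qed
    with F0(1,2) show ?thesis by (intro exI[of _ F0]) simp
  qed
  have lim: "((\<lambda>F. P F z) \<longlongrightarrow> Lim (finite_subsets_at_top A) (\<lambda>F. P F z))
      (finite_subsets_at_top A)" if z: "z \<in> K" for z
  proof -
    let ?\<F> = "filtermap (\<lambda>F. P F z) (finite_subsets_at_top A)"
    have "cauchy_filter ?\<F>"
      unfolding cauchy_filter_metric_filtermap
    proof (intro allI impI)
      fix e :: real assume "0 < e"
      then have "0 < e / 2" by simp
      from near[OF this] obtain F0 where F0: "finite F0" "F0 \<subseteq> A" and
        d: "\<forall>F z. finite F \<and> F0 \<subseteq> F \<and> F \<subseteq> A \<and> z \<in> K \<longrightarrow> dist (P F z) (P F0 z) < e / 2"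
        by (elim exE conjE)
      have "dist (P F z) (P F' z) < e" if "dist (P F z) (P F0 z) < e / 2"
        "dist (P F' z) (P F0 z) < e / 2" for F F'
        using that by (rule dist_triangle_half_l)
      moreover have "\<forall>\<^sub>F F in finite_subsets_at_top A. dist (P F z) (P F0 z) < e / 2"
        unfolding eventually_finite_subsets_at_top using F0 d z by (intro exI[of _ F0]) simp
      ultimately show "\<exists>Q. eventually Q (finite_subsets_at_top A) \<and>
          (\<forall>F F'. Q F \<and> Q F' \<longrightarrow> dist (P F z) (P F' z) < e)"
        by (intro exI[of _ "\<lambda>F. dist (P F z) (P F0 z) < e / 2"]) auto
    qed
    then obtain l where "?\<F> \<le> nhds l"
      using cauchy_filter_complete_converges[of ?\<F> UNIV] complete_UNIV
      by (auto simp: filtermap_bot_iff)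
    then have "((\<lambda>F. P F z) \<longlongrightarrow> l) (finite_subsets_at_top A)"
      by (simp add: filterlim_def)
    then show ?thesis using tendsto_Lim[of "finite_subsets_at_top A"] by auto
  qed
  have "uniform_limit K P (\<lambda>z. Lim (finite_subsets_at_top A) (\<lambda>F. P F z)) (finite_subsets_at_top A)"
  proof (rule uniform_limitI)
    fix e :: real assume "0 < e"
    then have "0 < e / 3" by simp
    from near[OF this] obtain F0 where F0: "finite F0" "F0 \<subseteq> A" and
      d: "\<forall>F z. finite F \<and> F0 \<subseteq> F \<and> F \<subseteq> A \<and> z \<in> K \<longrightarrow> dist (P F z) (P F0 z) < e / 3"
      by (elim exE conjE)
    have "dist (P F z) (Lim (finite_subsets_at_top A) (\<lambda>F. P F z)) < e"
      if F: "finite F" "F0 \<subseteq> F" "F \<subseteq> A" and z: "z \<in> K" for F z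
    proof -
      let ?L = "Lim (finite_subsets_at_top A) (\<lambda>F. P F z)"
      have "((\<lambda>F. dist (P F z) (P F0 z)) \<longlongrightarrow> dist ?L (P F0 z)) (finite_subsets_at_top A)"
        by (intro tendsto_intros lim z)
      moreover have "\<forall>\<^sub>F F in finite_subsets_at_top A. dist (P F z) (P F0 z) \<le> e / 3"
        unfolding eventually_finite_subsets_at_top using F0 d z
        by (intro exI[of _ F0]) (simp add: less_imp_le)
      ultimately have "dist ?L (P F0 z) \<le> e / 3"
        by (rule tendsto_upperbound) simp
      moreover have "dist (P F z) (P F0 z) < e / 3" using d F z by blast
      ultimately show ?thesis using \<open>0 < e\<close> dist_triangle2[of "P F z" ?L "P F0 z"] by linarith
    qed
    with F0 show "\<forall>\<^sub>F F in finite_subsets_at_top A. \<forall>z\<in>K.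
        dist (P F z) (Lim (finite_subsets_at_top A) (\<lambda>F. P F z)) < e"
      unfolding eventually_finite_subsets_at_top by (intro exI[of _ F0]) simp
  qed
  then show ?thesis by (simp add: P_def)
qed

text \<open>
  An absolutely convergent product without zero factors is nonzero: outside a finite set of indices
  all finite products lie within \<open>1/2\<close> of \<open>1\<close>, so the partial products stay away from \<open>0\<close>.
\<close>

lemma unordered_prod_nonzero:
  fixes f :: "'a \<Rightarrow> complex"
  assumes abs: "(\<lambda>x. norm (f x)) summable_on A" and nz: "\<And>x. x \<in> A \<Longrightarrow> 1 + f x \<noteq> 0"
    and lim: "((\<lambda>F. \<Prod>x\<in>F. 1 + f x) \<longlongrightarrow> P) (finite_subsets_at_top A)"
  shows "P \<noteq> 0"
proof -
  obtain F0 where F0: "finite F0" "F0 \<subseteq> A" and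
    tail: "\<And>G. finite G \<Longrightarrow> G \<subseteq> A - F0 \<Longrightarrow> norm ((\<Prod>x\<in>G. 1 + f x) - 1) < 1 / 2"
    using prod_tail_near_1[where K = "UNIV :: unit set" and f = "\<lambda>x _. f x" and e = "1 / 2", OF abs]
    by auto
  let ?P0 = "\<Prod>x\<in>F0. 1 + f x"
  have "norm ?P0 / 2 \<le> norm (\<Prod>x\<in>F. 1 + f x)" if F: "finite F" "F0 \<subseteq> F" "F \<subseteq> A" for F
  proof -
    let ?Q = "\<Prod>x\<in>F - F0. 1 + f x"
    have "1 / 2 \<le> norm ?Q"
      using tail[of "F - F0"] F norm_triangle_ineq2[of 1 "1 - ?Q"] norm_minus_commute[of 1 ?Q]
      by (simp add: Diff_mono)
    then have "norm ?P0 * (1 / 2) \<le> norm ?P0 * norm ?Q" by (rule mult_left_mono) simp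
    also have "\<dots> = norm (\<Prod>x\<in>F. 1 + f x)"
      using F by (metis mult.commute norm_mult prod.subset_diff)
    finally show ?thesis by simp
  qed
  then have "\<forall>\<^sub>F F in finite_subsets_at_top A. norm ?P0 / 2 \<le> norm (\<Prod>x\<in>F. 1 + f x)"
    unfolding eventually_finite_subsets_at_top using F0 by blast
  then have "norm ?P0 / 2 \<le> norm P"
    by (intro tendsto_lowerbound[OF tendsto_norm[OF lim]]) auto
  moreover have "?P0 \<noteq> 0" using F0 nz by auto
  ultimately show ?thesis by auto
qed

lemma unordered_prod_eq_0:
  fixes f :: "'a \<Rightarrow> complex"
  assumes "x \<in> A" "f x = 0"
  shows "((\<lambda>F. \<Prod>x\<in>F. f x) \<longlongrightarrow> 0) (finite_subsets_at_top A)"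
proof (rule tendsto_eventually)
  show "\<forall>\<^sub>F F in finite_subsets_at_top A. (\<Prod>x\<in>F. f x) = 0"
    unfolding eventually_finite_subsets_at_top
    using assms by (intro exI[of _ "{x}"]) auto
qed

section \<open>The double q-product\<close>

text \<open>
  The factor \<open>1 - p\<^sup>j q\<^sup>k u\<close>, where \<open>u\<close>, \<open>p\<close> and \<open>q\<close> are the exponentials of \<open>2\<pi>iz\<close>, \<open>2\<pi>i\<tau>\<close> and
  \<open>2\<pi>i\<sigma>\<close>. The additive variables are kept as arguments, so that shifts of \<open>z\<close> stay sums.
\<close>

definition qfactor :: "complex \<Rightarrow> complex \<Rightarrow> complex \<Rightarrow> nat \<times> nat \<Rightarrow> complex" where
  "qfactor z \<tau> \<sigma> = (\<lambda>(j, k). 1 - exp (2 * of_real pi * \<i> * (of_nat j * \<tau> + of_nat k * \<sigma> + z)))"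

text \<open>
  The double q-Pochhammer symbol \<open>(u; p, q)\<^sub>\<infinity>\<close>, that is, the product of all these factors as a limit
  along the net of finite sets of index pairs. It is meant for \<open>Im \<tau> > 0\<close> and \<open>Im \<sigma> > 0\<close>.
\<close>

definition double_qprod :: "complex \<Rightarrow> complex \<Rightarrow> complex \<Rightarrow> complex" where
  "double_qprod z \<tau> \<sigma> = Lim (finite_subsets_at_top UNIV) (\<lambda>F. \<Prod>x\<in>F. qfactor z \<tau> \<sigma> x)"

lemma summable_on_double_geometric:
  fixes p q :: real
  assumes "0 \<le> p" "p < 1" "0 \<le> q" "q < 1"
  shows "(\<lambda>(j, k). p ^ j * q ^ k) summable_on (UNIV :: (nat \<times> nat) set)"
proof -
  have "(\<lambda>(j, k). p ^ j * q ^ k) summable_on (UNIV :: nat set) \<times> (UNIV :: nat set)"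
  proof (rule summable_on_SigmaI[where g = "\<lambda>j. p ^ j * (1 / (1 - q))"])
    show "((\<lambda>k. case (j, k) of (j, k) \<Rightarrow> p ^ j * q ^ k) has_sum p ^ j * (1 / (1 - q))) UNIV" for j
      using assms unfolding case_prod_conv
      by (intro sums_nonneg_imp_has_sum sums_mult geometric_sums) auto
    show "(\<lambda>j. p ^ j * (1 / (1 - q))) summable_on UNIV"
      using assms
      by (intro summable_on_cmult_left summable_nonneg_imp_summable_on summable_geometric) auto
  qed (use assms in auto)
  then show ?thesis by simp
qed

text \<open>
  On the half-plane \<open>Im z \<ge> -R\<close> the factors deviate from \<open>1\<close> by at most a summable amount
  that does not depend on \<open>z\<close>.
\<close>

lemma qfactor_dominated:
  assumes "Im \<tau> > 0" "Im \<sigma> > 0"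
  obtains M where "M summable_on UNIV" "\<And>x. 0 \<le> M x"
    "\<And>x z. - R \<le> Im z \<Longrightarrow> norm (qfactor z \<tau> \<sigma> x - 1) \<le> M x"
proof
  let ?M = "\<lambda>x. exp (2 * pi * R) *
    (case x of (j, k) \<Rightarrow> exp (- 2 * pi * Im \<tau>) ^ j * exp (- 2 * pi * Im \<sigma>) ^ k)"
  show "?M summable_on UNIV"
    using assms by (intro summable_on_cmult_right summable_on_double_geometric) auto
  show "0 \<le> ?M x" for x by (auto split: prod.split)
  show "norm (qfactor z \<tau> \<sigma> x - 1) \<le> ?M x" if "- R \<le> Im z" for x z
  proof (cases x)
    case (Pair j k)
    have "norm (qfactor z \<tau> \<sigma> x - 1) = exp (- 2 * pi * (real j * Im \<tau> + real k * Im \<sigma> + Im z))"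
      by (simp add: qfactor_def Pair)
    also have "\<dots> \<le> exp (2 * pi * R + real j * (- 2 * pi * Im \<tau>) + real k * (- 2 * pi * Im \<sigma>))"
    proof -
      have "2 * pi * (- Im z) \<le> 2 * pi * R"
        using that by (intro mult_left_mono) auto
      then show ?thesis by (simp add: algebra_simps)
    qed
    also have "\<dots> = ?M x"
      by (simp only: Pair exp_add exp_of_nat_mult case_prod_conv mult.assoc)
    finally show ?thesis .
  qed
qed

lemma qfactor_summable:
  assumes "Im \<tau> > 0" "Im \<sigma> > 0"
  shows "(\<lambda>x. norm (qfactor z \<tau> \<sigma> x - 1)) summable_on UNIV"
proof -
  obtain M where M: "M summable_on UNIV"
    and le: "\<And>x w. - (- Im z) \<le> Im w \<Longrightarrow> norm (qfactor w \<tau> \<sigma> x - 1) \<le> M x"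
    by (rule qfactor_dominated[OF assms]) blast
  show ?thesis
    by (rule summable_on_comparison_test[OF M]) (simp_all add: le)
qed

lemma double_qprod_uniform_limit:
  assumes "Im \<tau> > 0" "Im \<sigma> > 0"
  shows "uniform_limit {z. - R \<le> Im z} (\<lambda>F z. \<Prod>x\<in>F. qfactor z \<tau> \<sigma> x)
    (\<lambda>z. double_qprod z \<tau> \<sigma>) (finite_subsets_at_top UNIV)"
proof -
  obtain M where "M summable_on UNIV" "\<And>x. 0 \<le> M x"
    "\<And>x z. - R \<le> Im z \<Longrightarrow> norm (qfactor z \<tau> \<sigma> x - 1) \<le> M x"
    using qfactor_dominated[OF assms] by blast
  from Weierstrass_m_test_unordered_prod[OF this(1), where f = "\<lambda>x z. qfactor z \<tau> \<sigma> x - 1"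
      and K = "{z. - R \<le> Im z}"] this(2,3)
  show ?thesis by (simp add: double_qprod_def)
qed

lemma double_qprod_tendsto:
  assumes "Im \<tau> > 0" "Im \<sigma> > 0"
  shows "((\<lambda>F. \<Prod>x\<in>F. qfactor z \<tau> \<sigma> x) \<longlongrightarrow> double_qprod z \<tau> \<sigma>) (finite_subsets_at_top UNIV)"
  by (rule tendsto_uniform_limitI[OF double_qprod_uniform_limit[OF assms, of "- Im z"]]) simp

lemma double_qprod_eq_0_iff:
  assumes "Im \<tau> > 0" "Im \<sigma> > 0"
  shows "double_qprod z \<tau> \<sigma> = 0 \<longleftrightarrow> (\<exists>x. qfactor z \<tau> \<sigma> x = 0)"
proof
  assume "\<exists>x. qfactor z \<tau> \<sigma> x = 0"
  then obtain x where "qfactor z \<tau> \<sigma> x = 0" ..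
  then have "((\<lambda>F. \<Prod>x\<in>F. qfactor z \<tau> \<sigma> x) \<longlongrightarrow> 0) (finite_subsets_at_top UNIV)"
    by (rule unordered_prod_eq_0[OF UNIV_I])
  then show "double_qprod z \<tau> \<sigma> = 0"
    using double_qprod_tendsto[OF assms] tendsto_unique finite_subsets_at_top_neq_bot by blast
next
  assume "double_qprod z \<tau> \<sigma> = 0"
  then show "\<exists>x. qfactor z \<tau> \<sigma> x = 0"
    using unordered_prod_nonzero[OF qfactor_summable[OF assms], of z "double_qprod z \<tau> \<sigma>"]
      double_qprod_tendsto[OF assms, of z] by auto
qed

text \<open>A disc lies in some half-plane \<open>Im z \<ge> -R\<close>, so the convergence is locally uniform.\<close>

lemma double_qprod_holomorphic:
  assumes "Im \<tau> > 0" "Im \<sigma> > 0"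
  shows "(\<lambda>z. double_qprod z \<tau> \<sigma>) holomorphic_on UNIV"
proof -
  have hol: "(\<lambda>z. \<Prod>x\<in>F. qfactor z \<tau> \<sigma> x) holomorphic_on S" for F S
    unfolding qfactor_def case_prod_unfold by (intro holomorphic_intros)
  have "(\<lambda>z. double_qprod z \<tau> \<sigma>) holomorphic_on ball w 1" for w
  proof (rule holomorphic_uniform_limit)
    show "\<forall>\<^sub>F F in finite_subsets_at_top UNIV.
        continuous_on (cball w 1) (\<lambda>z. \<Prod>x\<in>F. qfactor z \<tau> \<sigma> x) \<and>
        (\<lambda>z. \<Prod>x\<in>F. qfactor z \<tau> \<sigma> x) holomorphic_on ball w 1"
      using hol holomorphic_on_imp_continuous_on by (intro always_eventually) blast
    have "cball w 1 \<subseteq> {z. - (1 - Im w) \<le> Im z}"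
    proof
      fix z assume "z \<in> cball w 1"
      then have "\<bar>Im (w - z)\<bar> \<le> 1"
        using abs_Im_le_cmod[of "w - z"] by (simp add: dist_norm)
      then show "z \<in> {z. - (1 - Im w) \<le> Im z}" by simp
    qed
    then show "uniform_limit (cball w 1) (\<lambda>F z. \<Prod>x\<in>F. qfactor z \<tau> \<sigma> x)
        (\<lambda>z. double_qprod z \<tau> \<sigma>) (finite_subsets_at_top UNIV)"
      by (rule uniform_limit_on_subset[OF double_qprod_uniform_limit[OF assms]])
  qed auto
  then have "(\<lambda>z. double_qprod z \<tau> \<sigma>) holomorphic_on (\<Union>w. ball w 1)"
    by (intro holomorphic_on_UN_open) auto
  moreover have "(\<Union>w::complex. ball w 1) = UNIV" using centre_in_ball by fastforce
  ultimately show ?thesis by simp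
qed

text \<open>
  Splitting the index pairs by their residues modulo \<open>m\<close> and \<open>n\<close>. If \<open>F\<close> runs through the finite sets
  of quotient pairs, the sets of all pairs with quotients in \<open>F\<close> are cofinal among the finite sets.
\<close>

lemma double_qprod_multiplication:
  fixes m n :: nat
  assumes "m > 0" "n > 0" "Im \<tau> > 0" "Im \<sigma> > 0"
  shows "double_qprod z \<tau> \<sigma> =
    (\<Prod>r<m. \<Prod>s<n. double_qprod (z + of_nat r * \<tau> + of_nat s * \<sigma>) (of_nat m * \<tau>) (of_nat n * \<sigma>))"
proof -
  define \<phi> :: "(nat \<times> nat) \<times> (nat \<times> nat) \<Rightarrow> nat \<times> nat"
    where "\<phi> = (\<lambda>((r, s), (j, k)). (m * j + r, n * k + s))"
  define R where "R = {..<m} \<times> {..<n}"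
  have inj: "inj_on \<phi> (R \<times> F)" for F
  proof (rule inj_on_inverseI)
    fix x assume "x \<in> R \<times> F"
    then show "(\<lambda>(j, k). ((j mod m, k mod n), (j div m, k div n))) (\<phi> x) = x"
      by (auto simp: \<phi>_def R_def)
  qed
  have "\<forall>\<^sub>F F in finite_subsets_at_top UNIV. finite (\<phi> ` (R \<times> F)) \<and> X \<subseteq> \<phi> ` (R \<times> F)"
    if "finite X" for X
    unfolding eventually_finite_subsets_at_top
  proof (intro exI conjI allI impI)
    let ?Y = "(\<lambda>(j, k). (j div m, k div n)) ` X"
    show "finite ?Y" using that by simp
    fix F assume F: "finite F \<and> ?Y \<subseteq> F \<and> F \<subseteq> UNIV"
    then show "finite (\<phi> ` (R \<times> F))" by (simp add: R_def)
    show "X \<subseteq> \<phi> ` (R \<times> F)"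
    proof
      fix x assume x: "x \<in> X"
      obtain j k where jk: "x = (j, k)" by fastforce
      then have "((j mod m, k mod n), (j div m, k div n)) \<in> R \<times> F"
        using F x assms by (force simp: R_def)
      moreover have "x = \<phi> ((j mod m, k mod n), (j div m, k div n))"
        by (simp add: \<phi>_def jk)
      ultimately show "x \<in> \<phi> ` (R \<times> F)" by blast
    qed
  qed auto
  then have "filterlim (\<lambda>F. \<phi> ` (R \<times> F)) (finite_subsets_at_top UNIV) (finite_subsets_at_top UNIV)"
    by (simp add: filterlim_finite_subsets_at_top)
  with double_qprod_tendsto[OF assms(3,4)]
  have "((\<lambda>F. \<Prod>x\<in>\<phi> ` (R \<times> F). qfactor z \<tau> \<sigma> x) \<longlongrightarrow> double_qprod z \<tau> \<sigma>)
      (finite_subsets_at_top UNIV)"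
    by (rule filterlim_compose)
  moreover have "(\<Prod>x\<in>\<phi> ` (R \<times> F). qfactor z \<tau> \<sigma> x) =
      (\<Prod>r<m. \<Prod>s<n. \<Prod>x\<in>F.
        qfactor (z + of_nat r * \<tau> + of_nat s * \<sigma>) (of_nat m * \<tau>) (of_nat n * \<sigma>) x)" for F
  proof -
    have "(\<Prod>x\<in>\<phi> ` (R \<times> F). qfactor z \<tau> \<sigma> x) = (\<Prod>y\<in>R \<times> F. qfactor z \<tau> \<sigma> (\<phi> y))"
      by (simp add: prod.reindex[OF inj])
    also have "\<dots> = (\<Prod>r<m. \<Prod>s<n. \<Prod>x\<in>F. qfactor z \<tau> \<sigma> (\<phi> ((r, s), x)))"
    proof -
      have "(\<Prod>y\<in>R \<times> F. qfactor z \<tau> \<sigma> (\<phi> y)) = (\<Prod>rs\<in>R. \<Prod>x\<in>F. qfactor z \<tau> \<sigma> (\<phi> (rs, x)))"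
        by (simp only: prod.cartesian_product split_def prod.collapse)
      then show ?thesis
        by (simp only: R_def prod.cartesian_product' split_def prod.collapse)
    qed
    also have "\<dots> = (\<Prod>r<m. \<Prod>s<n. \<Prod>x\<in>F.
        qfactor (z + of_nat r * \<tau> + of_nat s * \<sigma>) (of_nat m * \<tau>) (of_nat n * \<sigma>) x)"
      by (intro prod.cong refl) (auto simp: qfactor_def \<phi>_def algebra_simps)
    finally show ?thesis .
  qed
  moreover have "((\<lambda>F. \<Prod>r<m. \<Prod>s<n. \<Prod>x\<in>F.
        qfactor (z + of_nat r * \<tau> + of_nat s * \<sigma>) (of_nat m * \<tau>) (of_nat n * \<sigma>) x) \<longlongrightarrow>
      (\<Prod>r<m. \<Prod>s<n. double_qprod (z + of_nat r * \<tau> + of_nat s * \<sigma>) (of_nat m * \<tau>) (of_nat n * \<sigma>)))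
      (finite_subsets_at_top UNIV)"
    using assms by (intro tendsto_prod double_qprod_tendsto) auto
  ultimately show ?thesis
    using tendsto_unique finite_subsets_at_top_neq_bot by fastforce
qed

section \<open>The elliptic gamma function\<close>

text \<open>
  At a zero of the denominator the quotient is \<open>0\<close> by the convention for division by zero; so is
  the elliptic gamma function, as one of its factors is \<open>0\<close> by the same convention.
\<close>

lemma elliptic_gamma_eq_double_qprod_quotient:
  assumes "Im \<tau> > 0" "Im \<sigma> > 0"
  shows "elliptic_gamma z \<tau> \<sigma> = double_qprod (\<tau> + \<sigma> - z) \<tau> \<sigma> / double_qprod z \<tau> \<sigma>"
proof -
  have eq: "elliptic_gamma z \<tau> \<sigma> = Lim (finite_subsets_at_top UNIV)
      (\<lambda>F. \<Prod>x\<in>F. qfactor (\<tau> + \<sigma> - z) \<tau> \<sigma> x / qfactor z \<tau> \<sigma> x)"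
    by (simp add: elliptic_gamma_def qfactor_def case_prod_unfold algebra_simps)
  have "((\<lambda>F. \<Prod>x\<in>F. qfactor (\<tau> + \<sigma> - z) \<tau> \<sigma> x / qfactor z \<tau> \<sigma> x) \<longlongrightarrow>
      double_qprod (\<tau> + \<sigma> - z) \<tau> \<sigma> / double_qprod z \<tau> \<sigma>) (finite_subsets_at_top UNIV)"
  proof (cases "double_qprod z \<tau> \<sigma> = 0")
    case True
    then obtain x where "qfactor z \<tau> \<sigma> x = 0"
      using double_qprod_eq_0_iff[OF assms] by blast
    then show ?thesis
      using True by (auto intro!: unordered_prod_eq_0[of x])
  next
    case False
    then show ?thesis
      unfolding prod_dividef by (intro tendsto_divide double_qprod_tendsto assms)
  qed
  then show ?thesis
    unfolding eq by (intro tendsto_Lim) simp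
qed

lemma elliptic_gamma_meromorphic:
  assumes "Im \<tau> > 0" "Im \<sigma> > 0"
  shows "(\<lambda>z. elliptic_gamma (z + c) \<tau> \<sigma>) meromorphic_on UNIV"
proof -
  have "(\<lambda>z. double_qprod (g z) \<tau> \<sigma>) meromorphic_on UNIV" if "g holomorphic_on UNIV" for g
    using holomorphic_on_compose[OF that holomorphic_on_subset[OF double_qprod_holomorphic[OF assms]]]
    by (intro analytic_on_imp_meromorphic_on) (auto simp: o_def analytic_on_open)
  then show ?thesis
    unfolding elliptic_gamma_eq_double_qprod_quotient[OF assms]
    by (intro meromorphic_on_divide) (simp_all add: holomorphic_on_diff holomorphic_on_add)
qed

text \<open>
  The equality holds at every point, also at the poles, where both sides have the value \<open>0\<close>.
\<close>

lemma elliptic_gamma_multiplication: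
  fixes a b :: nat
  assumes "a > 0" "b > 0" "Im \<tau> > 0"
  shows "elliptic_gamma z (of_nat a * \<tau>) (of_nat b * \<tau>) =
    (\<Prod>r<b. \<Prod>s<a. elliptic_gamma (z + of_nat (a * r + b * s) * \<tau>)
      (of_nat (a * b) * \<tau>) (of_nat (a * b) * \<tau>))"
proof -
  let ?c = "of_nat (a * b) * \<tau>"
  \<comment> \<open>Needed for the numerators, where \<open>a (b-1-r) + b (a-1-s) = 2ab - a - b - (ar + bs)\<close>.\<close>
  have reverse: "(\<Prod>r<b. \<Prod>s<a. f r s) = (\<Prod>r<b. \<Prod>s<a. f (b - Suc r) (a - Suc s))"
    for f :: "nat \<Rightarrow> nat \<Rightarrow> complex"
  proof -
    have "(\<Prod>r<b. \<Prod>s<a. f r s) = (\<Prod>r<b. \<Prod>s<a. f (b - Suc r) s)"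
      by (rule prod.nat_diff_reindex[symmetric])
    also have "\<dots> = (\<Prod>r<b. \<Prod>s<a. f (b - Suc r) (a - Suc s))"
      by (rule prod.cong[OF refl], rule prod.nat_diff_reindex[symmetric])
    finally show ?thesis .
  qed
  have mult: "double_qprod w (of_nat a * \<tau>) (of_nat b * \<tau>) =
      (\<Prod>r<b. \<Prod>s<a. double_qprod (w + of_nat (a * r + b * s) * \<tau>) ?c ?c)" for w
    using double_qprod_multiplication[of b a "of_nat a * \<tau>" "of_nat b * \<tau>" w] assms
    by (simp add: algebra_simps)
  have "double_qprod (of_nat a * \<tau> + of_nat b * \<tau> - z) (of_nat a * \<tau>) (of_nat b * \<tau>) =
      (\<Prod>r<b. \<Prod>s<a. double_qprod (of_nat a * \<tau> + of_nat b * \<tau> - z +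
        of_nat (a * (b - Suc r) + b * (a - Suc s)) * \<tau>) ?c ?c)"
    unfolding mult by (rule reverse)
  also have "\<dots> = (\<Prod>r<b. \<Prod>s<a. double_qprod (?c + ?c - (z + of_nat (a * r + b * s) * \<tau>)) ?c ?c)"
  proof (intro prod.cong refl, goal_cases)
    case (1 r s)
    then have "of_nat (b - Suc r) = (of_nat b - 1 - of_nat r :: complex)"
      "of_nat (a - Suc s) = (of_nat a - 1 - of_nat s :: complex)"
      by auto
    then have "(of_nat (a * (b - Suc r) + b * (a - Suc s)) :: complex) =
        2 * of_nat (a * b) - of_nat a - of_nat b - of_nat (a * r + b * s)"
      by (simp only: of_nat_add of_nat_mult) (simp add: algebra_simps)
    then have "of_nat a * \<tau> + of_nat b * \<tau> - z + of_nat (a * (b - Suc r) + b * (a - Suc s)) * \<tau> =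
        ?c + ?c - (z + of_nat (a * r + b * s) * \<tau>)"
      by (simp only:) (simp add: algebra_simps)
    then show ?case by (rule arg_cong)
  qed
  finally have num: "double_qprod (of_nat a * \<tau> + of_nat b * \<tau> - z) (of_nat a * \<tau>) (of_nat b * \<tau>) =
      (\<Prod>r<b. \<Prod>s<a. double_qprod (?c + ?c - (z + of_nat (a * r + b * s) * \<tau>)) ?c ?c)" .
  have "Im ?c > 0" "Im (of_nat a * \<tau>) > 0" "Im (of_nat b * \<tau>) > 0"
    using assms by auto
  then show ?thesis
    by (simp only: elliptic_gamma_eq_double_qprod_quotient num mult[of z] prod_dividef)
qed

theorem theorem5p4:
  fixes a b :: nat and \<tau> :: complex
  assumes "a > 0" and "b > 0" and "Im \<tau> > 0"
  shows "eq_meromorphic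
           (\<lambda>z. elliptic_gamma z (of_nat a * \<tau>) (of_nat b * \<tau>))
           (\<lambda>z. \<Prod>r = 0..b - 1. \<Prod>s = 0..a - 1.
              elliptic_gamma (z + of_nat (a * r + b * s) * \<tau>)
                (of_nat (a * b) * \<tau>) (of_nat (a * b) * \<tau>))"
proof -
  have ranges: "{0..b - 1} = {..<b}" "{0..a - 1} = {..<a}"
    using assms by auto
  have "(\<lambda>z. elliptic_gamma (z + 0) (of_nat a * \<tau>) (of_nat b * \<tau>)) meromorphic_on UNIV"
    using assms by (intro elliptic_gamma_meromorphic) auto
  then show ?thesis
    unfolding eq_meromorphic_def ranges elliptic_gamma_multiplication[OF assms, symmetric]
    by simp
qed

end
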